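(* Let $n \geq 1$ be an integer and let $a_0, a_1, \ldots, a_n, \widehat{a}_1, \widehat{a}_2, \ldots, \widehat{a}_n$ be arbitrary non-negative integers. Let $p$ be the maximum $p' \in \{1, 2, \ldots, n\}$ such that $\sum_{i = p'}^n (a_i - \widehat{a}_i) < 0$, with $p = 0$ if no such $p'$ exists. Then $$\mathcal{G}\left( \ast a_0 :_{\ast \widehat{a}_1} \ast a_1 :_{\ast \widehat{a}_2} \ast a_2 :_{\ast \widehat{a}_3} \cdots :_{\ast \widehat{a}_n} \ast a_n \right) = \sum_{i = p}^n a_i.$$
   Context: Impartial games: set $\widetilde{\mathbb{G}}_0 = \{\emptyset\}$ and $\widetilde{\mathbb{G}}_n = 2^{\widetilde{\mathbb{G}}_{n-1}}$ (power set) for $n \geq 1$, and $\widetilde{\mathbb{G}} = \bigcup_{n \in \mathbb{Z}_{\geq 0}} \widetilde{\mathbb{G}}_n$. Elements of $\widetilde{\mathbb{G}}$ are called games; the elements of a game $G$ are its options. Nimbers: for $n \in \mathbb{Z}_{\geq 0}$, the game $\ast n$ is defined recursively by $\ast n = \{\ast n' \mid n' \in \mathbb{Z}_{\geq 0}, n' < n\}$; in particular $\ast 0 = \emptyset$. Ordinal sum with substitution: for $G, H, \widehat{H} \in \widetilde{\mathbb{G}}$, the game $G :_{\widehat{H}} H$ is defined recursively by $$G :_{\widehat{H}} H = \{ G' :_{\widehat{H}} \widehat{H} \mid G' \in G\} \cup \{ G :_{\widehat{H}} H' \mid H' \in H \}.$$ When parentheses are omitted, operations are performed from left to right: $G_0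 :_{\widehat{G}_1} G_1 :_{\widehat{G}_2} G_2 :_{\widehat{G}_3} \cdots :_{\widehat{G}_n} G_n$ means $(\ldots((G_0 :_{\widehat{G}_1} G_1) :_{\widehat{G}_2} G_2) :_{\widehat{G}_3} \ldots ) :_{\widehat{G}_n} G_n$. The Grundy number of a game is defined recursively by $\mathcal{G}(G) = \operatorname{mex}\{\mathcal{G}(G') \mid G' \in G\}$, where $\operatorname{mex} A = \min(\mathbb{Z}_{\geq 0} \setminus A)$ for $A \subsetneq \mathbb{Z}_{\geq 0}$. *)

theory Defs
  imports Main "HOL-Library.FSet"
begin

text \<open>
  An impartial game is a hereditarily finite set: a finite set of games, its options.
  Since datatypes may recurse through \<open>fset\<close>, equality of games is extensional, and
  \<open>games_UN_level\<close> below shows that this type is exactly the union of the levels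
  G(0) = {{}}, G(n+1) = Pow (G(n)).
\<close>

datatype game = Game (options: "game fset")

primrec game_level :: "nat \<Rightarrow> game set" where
  "game_level 0 = {Game {||}}"
| "game_level (Suc n) = {G. fset (options G) \<subseteq> game_level n}"

lemma game_level_mono: "m \<le> n \<Longrightarrow> game_level m \<subseteq> game_level n"
proof -
  have step: "game_level n \<subseteq> game_level (Suc n)" for n
    by (induction n) auto
  show "m \<le> n \<Longrightarrow> game_level m \<subseteq> game_level n"
    using lift_Suc_mono_le[of game_level, OF step] by blast
qed

lemma games_UN_level: "(\<Union>n. game_level n) = UNIV"
proof -
  have "\<exists>n. G \<in> game_level n" for G
  proof (induction G)
    case (Game X)
    then obtain f where f: "\<And>G. G \<in> fset X \<Longrightarrow> G \<in> game_level (f G)"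
      by metis
    define N where "N = Max (insert 0 (f ` fset X))"
    have "f G \<le> N" if "G \<in> fset X" for G
      using that by (auto simp: N_def intro!: Max_ge)
    then have "fset X \<subseteq> game_level N"
      using f game_level_mono by blast
    then have "Game X \<in> game_level (Suc N)" by simp
    then show ?case by blast
  qed
  then show ?thesis by blast
qed

lemma size_option [termination_simp]:
  assumes "G' |\<in>| options G"
  shows "size G' < size G"
proof (cases G)
  case (Game X)
  then have "Suc (size G') \<le> (\<Sum>x\<in>fset X. Suc (size x))"
    using assms by (intro member_le_sum) auto
  with Game show ?thesis by (simp add: size_fset_overloaded_simps)
qed

function nimber :: "nat \<Rightarrow> game" where
  "nimber n = Game (nimber |`| fset_of_list [0..<n])"
  by auto
termination
  by (relation "measure id") (auto simp: fset_of_list_elem)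

text \<open>\<open>ordinal_sum G K H\<close> is G :_K H: a move in G resets the second component to K.\<close>

function ordinal_sum :: "game \<Rightarrow> game \<Rightarrow> game \<Rightarrow> game" where
  "ordinal_sum G K H =
     Game ((\<lambda>G'. ordinal_sum G' K K) |`| options G |\<union>|
           (\<lambda>H'. ordinal_sum G K H') |`| options H)"
  by auto
termination
  by (relation "measures [\<lambda>(G, K, H). size G, \<lambda>(G, K, H). size H]")
     (auto simp: size_option)

text \<open>
  \<open>ordinal_sum_chain G K n\<close> is G_0 :_{K_1} G_1 :_{K_2} ... :_{K_n} G_n, bracketed to the
  left. The value \<open>K 0\<close> is never used.
\<close>

primrec ordinal_sum_chain :: "(nat \<Rightarrow> game) \<Rightarrow> (nat \<Rightarrow> game) \<Rightarrow> nat \<Rightarrow> game" where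
  "ordinal_sum_chain G K 0 = G 0"
| "ordinal_sum_chain G K (Suc n) =
     ordinal_sum (ordinal_sum_chain G K n) (K (Suc n)) (G (Suc n))"

text \<open>\<open>mex A\<close> is the intended value only for proper subsets A of the naturals; it is
  applied below to finite sets only.\<close>

definition mex :: "nat set \<Rightarrow> nat" where
  "mex A = (LEAST n. n \<notin> A)"

function grundy :: "game \<Rightarrow> nat" where
  "grundy G = mex (grundy ` fset (options G))"
  by auto
termination
  by (relation "measure size") (auto simp: size_option)

declare nimber.simps [simp del] ordinal_sum.simps [simp del] grundy.simps [simp del]

end

theory Submission imports Defs "HOL-Library.Infinite_Set"
begin

text \<open>
  Let \<open>A\<close> be the set of Grundy numbers of the options of \<open>G\<close>, and let \<open>f\<close> enumerate the
  complement of \<open>A\<close> increasingly, so that the Grundy number of \<open>G\<close> is \<open>f 0\<close>. Since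
  \<open>G' :_{*k} *k\<close> has Grundy number \<open>k\<close> plus that of \<open>G'\<close>, the moves in \<open>G\<close> contribute \<open>k + A\<close>
  to \<open>G :_{*k} *n\<close>, and its Grundy number is the entry number \<open>n\<close> of the enumeration \<open>\<phi>\<close> of the
  complement of \<open>k + A\<close>, where \<open>\<phi> b = b\<close> for \<open>b < k\<close> and \<open>\<phi> b = k + f (b - k)\<close> otherwise. The
  corresponding enumeration for \<open>G :_{*k} *n\<close> itself is \<open>e \<mapsto> \<phi> (n + e)\<close>. Iterating this along the
  chain, the offset \<open>e\<close> accumulates the differences \<open>a i - ahat i\<close> from the right, and the
  recursion stops at the first index where the accumulated sum becomes negative.
\<close>

definition enumerates_compl :: "(nat \<Rightarrow> nat) \<Rightarrow> nat set \<Rightarrow> bool" where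
  "enumerates_compl f A \<longleftrightarrow> strict_mono f \<and> range f = - A"

definition shift_enum :: "nat \<Rightarrow> (nat \<Rightarrow> nat) \<Rightarrow> nat \<Rightarrow> nat" where
  "shift_enum k f b = (if b < k then b else k + f (b - k))"

lemma enumerates_compl_exists:
  assumes "finite A"
  shows "\<exists>f. enumerates_compl f A"
proof
  have inf: "infinite (- A)"
    using assms by (simp add: Compl_eq_Diff_UNIV)
  show "enumerates_compl (enumerate (- A)) A"
    unfolding enumerates_compl_def
    using strict_mono_enumerate[OF inf] range_enumerate[OF inf] by blast
qed

text \<open>Since \<open>f\<close> is increasing, adding its first \<open>n\<close> values to
  \<open>A\<close> leaves exactly the later ones in the complement. This is the effect of the moves
  in \<open>*n\<close>, which contribute the entries with index below \<open>n\<close>.\<close>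

lemma enumerates_compl_drop:
  assumes "enumerates_compl f A"
  shows "enumerates_compl (\<lambda>e. f (n + e)) (A \<union> f ` {..<n})"
proof -
  have mono: "strict_mono f" and rng: "range f = - A"
    using assms by (auto simp: enumerates_compl_def)
  have "range (\<lambda>e. f (n + e)) = f ` {n..}"
    by (auto simp: image_iff) (metis le_add_diff_inverse)
  also have "{n..} = UNIV - {..<n}" by auto
  also have "f ` \<dots> = range f - f ` {..<n}"
    using strict_mono_imp_inj_on[OF mono] by (rule image_set_diff)
  also have "\<dots> = - (A \<union> f ` {..<n})" using rng by auto
  finally show ?thesis
    using mono by (auto simp: enumerates_compl_def strict_mono_def)
qed

lemma mex_enumerates_compl:
  assumes "enumerates_compl f A"
  shows "mex A = f 0"
  unfolding mex_def
proof (rule Least_equality)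
  show "f 0 \<notin> A"
    using assms by (auto simp: enumerates_compl_def)
next
  fix y assume "y \<notin> A"
  then obtain j where "y = f j"
    using assms by (auto simp: enumerates_compl_def)
  then show "f 0 \<le> y"
    using assms by (simp add: enumerates_compl_def strict_mono_less_eq)
qed

lemma mex_Un_enumerates_compl:
  assumes "enumerates_compl f A"
  shows "mex (A \<union> f ` {..<n}) = f n"
  using mex_enumerates_compl[OF enumerates_compl_drop[OF assms]] by simp

text \<open>No element of \<open>k + A\<close> lies below \<open>k\<close>, so the enumeration
  starts as the identity; from \<open>k\<close> on, the complement of \<open>A\<close> reappears
  translated by \<open>k\<close>.\<close>

lemma enumerates_compl_shift_enum:
  assumes "enumerates_compl f A"
  shows "enumerates_compl (shift_enum k f) ((+) k ` A)"
proof -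
  have mono: "strict_mono f" and rng: "range f = - A"
    using assms by (auto simp: enumerates_compl_def)
  have "x \<in> range (shift_enum k f) \<longleftrightarrow> x \<in> - ((+) k ` A)" for x
  proof (cases "x < k")
    case True
    then have "x = shift_enum k f x" by (simp add: shift_enum_def)
    with True show ?thesis by auto
  next
    case False
    then obtain y where y: "x = k + y" by (metis le_add_diff_inverse not_less)
    have "x \<in> range (shift_enum k f) \<longleftrightarrow> y \<in> range f"
    proof
      assume "x \<in> range (shift_enum k f)"
      then show "y \<in> range f"
        by (auto simp: y shift_enum_def split: if_splits)
    next
      assume "y \<in> range f"
      then obtain j where "y = f j" by blast
      then have "x = shift_enum k f (k + j)" by (simp add: y shift_enum_def)
      then show "x \<in> range (shift_enum k f)" by blast
    qed
    also have "\<dots> \<longleftrightarrow> x \<in> - ((+) k ` A)" by (auto simp: y rng)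
    finally show ?thesis .
  qed
  then have "range (shift_enum k f) = - ((+) k ` A)" by blast
  moreover have "strict_mono (shift_enum k f)"
    using mono by (auto simp: strict_mono_def shift_enum_def)
  ultimately show ?thesis by (simp add: enumerates_compl_def)
qed

abbreviation option_values :: "game \<Rightarrow> nat set" where
  "option_values G \<equiv> grundy ` fset (options G)"

lemma options_nimber: "fset (options (nimber n)) = nimber ` {..<n}"
  by (subst nimber.simps) (auto simp: fset_of_list.rep_eq)

lemma options_ordinal_sum:
  "fset (options (ordinal_sum G K H)) =
     (\<lambda>G'. ordinal_sum G' K K) ` fset (options G) \<union> ordinal_sum G K ` fset (options H)"
  by (subst ordinal_sum.simps) auto

lemma enumerates_compl_lessThan: "enumerates_compl (\<lambda>e. n + e) {..<n}"
proof -
  have "enumerates_compl id {}"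
    by (simp add: enumerates_compl_def strict_mono_def)
  from enumerates_compl_drop[OF this, of n] show ?thesis by simp
qed

lemma grundy_nimber: "grundy (nimber n) = n"
proof (induction n rule: less_induct)
  case (less n)
  then have "option_values (nimber n) = {..<n}"
    by (auto simp: options_nimber image_image)
  then show ?case
    using mex_enumerates_compl[OF enumerates_compl_lessThan[of n]]
    by (simp add: grundy.simps[of "nimber n"])
qed

lemma option_values_nimber: "option_values (nimber n) = {..<n}"
  by (simp add: options_nimber image_image grundy_nimber)

text \<open>The first assumption is the case \<open>n = k\<close> for the options of
  \<open>G\<close>. Keeping it as a hypothesis lets the lemma serve inside the induction that proves
  this case.\<close>

lemma grundy_ordinal_sum_nimber_step:
  assumes "\<And>G'. G' |\<in>| options G \<Longrightarrow>
             grundy (ordinal_sum G' (nimber k) (nimber k)) = k + grundy G'"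
    and "enumerates_compl f (option_values G)"
  shows "grundy (ordinal_sum G (nimber k) (nimber n)) = shift_enum k f n"
proof (induction n rule: less_induct)
  case (less n)
  have "option_values (ordinal_sum G (nimber k) (nimber n)) =
          (+) k ` option_values G \<union> shift_enum k f ` {..<n}"
    unfolding options_ordinal_sum options_nimber image_Un image_image
    using assms(1) less by (intro arg_cong2[where f = "(\<union>)"] image_cong) auto
  then show ?case
    using mex_Un_enumerates_compl[OF enumerates_compl_shift_enum[OF assms(2)]]
    by (simp add: grundy.simps[of "ordinal_sum _ _ _"])
qed

lemma grundy_ordinal_sum_nimber_same:
  "grundy (ordinal_sum G (nimber k) (nimber k)) = k + grundy G"
proof (induction G rule: measure_induct_rule[of size])
  case (less G)
  obtain f where f: "enumerates_compl f (option_values G)"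
    using enumerates_compl_exists[of "option_values G"] by auto
  \<comment> \<open>Options of \<open>G\<close> are smaller, so the induction hypothesis supplies
    the assumption on them.\<close>
  have "grundy (ordinal_sum G (nimber k) (nimber k)) = shift_enum k f k"
    using less size_option f by (intro grundy_ordinal_sum_nimber_step) auto
  also have "\<dots> = k + grundy G"
    using mex_enumerates_compl[OF f] by (simp add: shift_enum_def grundy.simps[of G])
  finally show ?case .
qed

lemma grundy_ordinal_sum_nimber:
  assumes "enumerates_compl f (option_values G)"
  shows "grundy (ordinal_sum G (nimber k) (nimber n)) = shift_enum k f n"
  using grundy_ordinal_sum_nimber_same assms by (rule grundy_ordinal_sum_nimber_step)

text \<open>The next ordinal sum depends on all option values and not just on their mex, so the
  whole enumeration is passed along the chain.\<close>

lemma enumerates_compl_ordinal_sum_nimber: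
  assumes "enumerates_compl f (option_values G)"
  shows "enumerates_compl (\<lambda>e. shift_enum k f (n + e))
           (option_values (ordinal_sum G (nimber k) (nimber n)))"
proof -
  have "option_values (ordinal_sum G (nimber k) (nimber n)) =
          (+) k ` option_values G \<union> shift_enum k f ` {..<n}"
    by (simp add: options_ordinal_sum options_nimber image_Un image_image
        grundy_ordinal_sum_nimber_same grundy_ordinal_sum_nimber[OF assms])
  then show ?thesis
    using enumerates_compl_drop[OF enumerates_compl_shift_enum[OF assms]] by simp
qed

primrec chain_enum :: "(nat \<Rightarrow> nat) \<Rightarrow> (nat \<Rightarrow> nat) \<Rightarrow> nat \<Rightarrow> nat \<Rightarrow> nat" where
  "chain_enum a ahat 0 = (\<lambda>e. a 0 + e)"
| "chain_enum a ahat (Suc m) =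
     (\<lambda>e. shift_enum (ahat (Suc m)) (chain_enum a ahat m) (a (Suc m) + e))"

lemma enumerates_compl_chain_enum:
  "enumerates_compl (chain_enum a ahat m)
     (option_values (ordinal_sum_chain (\<lambda>i. nimber (a i)) (\<lambda>i. nimber (ahat i)) m))"
  by (induction m)
     (simp_all add: option_values_nimber enumerates_compl_lessThan
        enumerates_compl_ordinal_sum_nimber)

text \<open>The offset \<open>e\<close> is general because the induction removes the last index and
  absorbs its difference into \<open>e\<close>; the tail sums that characterize \<open>p\<close> are
  therefore shifted by \<open>e\<close>.\<close>

lemma chain_enum_eq_sum:
  assumes "p \<le> m"
    and "\<And>j. p < j \<Longrightarrow> j \<le> m \<Longrightarrow> 0 \<le> int e + (\<Sum>i=j..m. int (a i) - int (ahat i))"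
    and "p = 0 \<or> int e + (\<Sum>i=p..m. int (a i) - int (ahat i)) < 0"
  shows "chain_enum a ahat m e = e + (\<Sum>i=p..m. a i)"
  using assms
proof (induction m arbitrary: e)
  case 0
  then show ?case by simp
next
  case (Suc m)
  show ?case
  proof (cases "p = Suc m")
    case True
    \<comment> \<open>Here \<open>a (Suc m) + e < ahat (Suc m)\<close>, so \<open>shift_enum\<close>
      acts as the identity and the recursion stops.\<close>
    with Suc.prems(3) show ?thesis by (simp add: shift_enum_def)
  next
    case False
    with Suc.prems(1) have p: "p \<le> m" by simp
    from Suc.prems(2)[of "Suc m"] p have ge: "ahat (Suc m) \<le> a (Suc m) + e" by simp
    \<comment> \<open>By \<open>ge\<close> the subtraction is exact; the amount taken off is added
      back by the outer summand of \<open>shift_enum\<close>.\<close>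
    define e' where "e' = a (Suc m) + e - ahat (Suc m)"
    have e': "int e' = int e + (int (a (Suc m)) - int (ahat (Suc m)))"
      using ge by (simp add: e'_def of_nat_diff)
    have "chain_enum a ahat m e' = e' + (\<Sum>i=p..m. a i)"
    proof (rule Suc.IH[OF p])
      fix j assume "p < j" "j \<le> m"
      with Suc.prems(2)[of j]
      show "0 \<le> int e' + (\<Sum>i=j..m. int (a i) - int (ahat i))"
        by (simp add: e' algebra_simps)
    next
      show "p = 0 \<or> int e' + (\<Sum>i=p..m. int (a i) - int (ahat i)) < 0"
        using Suc.prems(3) p by (simp add: e' algebra_simps)
    qed
    then show ?thesis
      using ge p by (simp add: shift_enum_def e'_def)
  qed
qed

theorem theorem3p10:
  fixes n :: nat and a ahat :: "nat \<Rightarrow> nat" and P :: "nat set" and p :: nat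
  assumes "n \<ge> 1"
    and "P = {p' \<in> {1..n}. (\<Sum>i=p'..n. int (a i) - int (ahat i)) < 0}"
    and "p = (if P = {} then 0 else Max P)"
  shows "grundy (ordinal_sum_chain (\<lambda>i. nimber (a i)) (\<lambda>i. nimber (ahat i)) n)
           = (\<Sum>i=p..n. a i)"
proof -
  have fin: "finite P" by (simp add: assms(2))
  have p: "p = 0 \<or> p \<in> P" using Max_in[OF fin] assms(3) by auto
  have above: "j \<notin> P" if "p < j" for j
    using Max_ge[OF fin, of j] that assms(3) by (auto split: if_splits)
  \<comment> \<open>Entry \<open>0\<close> of the enumeration is the mex, hence offset
    \<open>0\<close>.\<close>
  have "chain_enum a ahat n 0 = 0 + (\<Sum>i=p..n. a i)"
  proof (rule chain_enum_eq_sum)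
    show "p \<le> n" using p by (auto simp: assms(2))
    show "0 \<le> int 0 + (\<Sum>i=j..n. int (a i) - int (ahat i))" if "p < j" "j \<le> n" for j
    proof -
      have "j \<in> {1..n}" using that by simp
      then show ?thesis using above[OF that(1)] by (simp add: assms(2) not_less)
    qed
    show "p = 0 \<or> int 0 + (\<Sum>i=p..n. int (a i) - int (ahat i)) < 0"
      using p by (auto simp: assms(2))
  qed
  then show ?thesis
    using mex_enumerates_compl[OF enumerates_compl_chain_enum]
    by (simp add: grundy.simps[of "ordinal_sum_chain _ _ _"])
qed

end
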